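(* Let $S=K[x_1,\dots,x_n]$ be a polynomial ring over a field $K$ and let $I\subseteq S$ be a homogeneous, unmixed, radical ideal of height $h$. Suppose that $I$ is of König type with respect to $f_1,\dots,f_h$ and the monomial order $<$, and that the initial monomial $\operatorname{in}_<(f_i)$ is square-free for all $i=1,\dots,h$. Then $I$ is a Knutson ideal.
   Context: König type: a homogeneous ideal $I\subseteq S$ of height $h$ is of König type (with respect to $f_1,\dots,f_h$ and the monomial order $<$) if $f_1,\dots,f_h$ are homogeneous polynomials forming part of a minimal system of homogeneous generators of $I$, and $<$ is a monomial order on $S$ such that $\operatorname{in}_<(f_1),\dots,\operatorname{in}_<(f_h)$ is a regular sequence. Unmixed: all associated primes of $I$ have the same height. Knutson ideals: let $f\in S$ be a polynomial such that $\operatorname{in}_<(f)$ is a square-free monomial for some monomial order $<$ on $S$. $\mathcal{C}_f$ is the smallest set of ideals of $S$ such that: (1) $(f)\in\mathcal{C}_f$; (2) if $I\in\mathcal{C}_f$ and $J$ is any ideal of $S$, then $I:J\in\mathcal{C}_f$; (3) if $I,J\in\mathcal{C}_f$, then $I+J\in\mathcal{C}_f$ and $I\cap J\in\mathcal{C}_f$. An ideal $I$ is a Knutson ideal if $I\in\mathcal{C}_f$ for some such $f$.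
   Formalization: The height h is assumed to be at least 1; for h = 0 the ideal is I = (0), which meets all hypotheses with the empty sequence but is not Knutson, since every ideal in C_f contains the nonzero polynomial f. *)

theory Defs
  imports
    "HOL-Algebra.Algebraic_Closure_Type"
    "HOL-Algebra.Ideal"
    "HOL-Library.Poly_Mapping"
    "HOL-Library.Extended_Nat"
begin

section \<open>Ideals of a commutative ring\<close>

definition colon_ideal :: "('a, 'm) ring_scheme \<Rightarrow> 'a set \<Rightarrow> 'a set \<Rightarrow> 'a set" where
  "colon_ideal R I J = {x \<in> carrier R. \<forall>y\<in>J. x \<otimes>\<^bsub>R\<^esub> y \<in> I}"

definition radical_ideal :: "('a, 'm) ring_scheme \<Rightarrow> 'a set \<Rightarrow> bool" where
  "radical_ideal R I \<longleftrightarrow>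
     ideal I R \<and> (\<forall>x\<in>carrier R. \<forall>k::nat. x [^]\<^bsub>R\<^esub> k \<in> I \<longrightarrow> x \<in> I)"

text \<open>The associated primes of the module \<open>R/I\<close>: the primes of the form \<open>I : x\<close>.\<close>

definition associated_primes :: "('a, 'm) ring_scheme \<Rightarrow> 'a set \<Rightarrow> 'a set set" where
  "associated_primes R I = {P. primeideal P R \<and> (\<exists>x\<in>carrier R. P = colon_ideal R I {x})}"

text \<open>A nonempty list \<open>[P\<^sub>0, \<dots>, P\<^sub>k]\<close> of primes encodes a strict chain of length \<open>k\<close>.\<close>

definition prime_height :: "('a, 'm) ring_scheme \<Rightarrow> 'a set \<Rightarrow> enat" where
  "prime_height R P =
     (SUP Ps \<in> {Ps. Ps \<noteq> [] \<and> (\<forall>Q\<in>set Ps. primeideal Q R) \<and> sorted_wrt (\<subset>) Ps \<and> last Ps = P}.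
        enat (length Ps - 1))"

text \<open>For \<open>I = carrier R\<close> this is the infimum of the empty set, i.e. \<open>\<infinity>\<close>; so an ideal whose
  height is a natural number is proper.\<close>

definition ideal_height :: "('a, 'm) ring_scheme \<Rightarrow> 'a set \<Rightarrow> enat" where
  "ideal_height R I = (INF P \<in> {P. primeideal P R \<and> I \<subseteq> P}. prime_height R P)"

definition unmixed :: "('a, 'm) ring_scheme \<Rightarrow> 'a set \<Rightarrow> bool" where
  "unmixed R I \<longleftrightarrow>
     (\<forall>P\<in>associated_primes R I. \<forall>Q\<in>associated_primes R I. prime_height R P = prime_height R Q)"

definition regular_sequence :: "('a, 'm) ring_scheme \<Rightarrow> 'a list \<Rightarrow> bool" where
  "regular_sequence R as \<longleftrightarrow>
     set as \<subseteq> carrier R \<and>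
     (\<forall>i<length as. \<forall>x\<in>carrier R.
        as ! i \<otimes>\<^bsub>R\<^esub> x \<in> Idl\<^bsub>R\<^esub> (set (take i as)) \<longrightarrow> x \<in> Idl\<^bsub>R\<^esub> (set (take i as))) \<and>
     Idl\<^bsub>R\<^esub> (set as) \<noteq> carrier R"


section \<open>Polynomial rings\<close>

text \<open>The variables are the elements of a finite type \<open>'v\<close>, so \<open>n = CARD('v)\<close>. Exponent vectors
  have type \<open>'v \<Rightarrow>\<^sub>0 nat\<close>, and a polynomial maps exponent vectors to coefficients.\<close>

type_synonym 'v exponent = "'v \<Rightarrow>\<^sub>0 nat"
type_synonym ('v, 'k) mpoly = "'v exponent \<Rightarrow>\<^sub>0 'k"

abbreviation mpoly_ring :: "('v::finite, 'k::field) mpoly ring" where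
  "mpoly_ring \<equiv> ring_of_type_algebra"

definition homogeneous :: "('v::finite, 'k::field) mpoly \<Rightarrow> bool" where
  "homogeneous p \<longleftrightarrow> (\<exists>d. \<forall>t\<in>Poly_Mapping.keys p. (\<Sum>v\<in>UNIV. Poly_Mapping.lookup t v) = d)"

definition homogeneous_ideal :: "('v::finite, 'k::field) mpoly set \<Rightarrow> bool" where
  "homogeneous_ideal I \<longleftrightarrow> (\<exists>G. (\<forall>g\<in>G. homogeneous g) \<and> I = Idl\<^bsub>mpoly_ring\<^esub> G)"

definition minimal_homogeneous_generators ::
    "('v::finite, 'k::field) mpoly set \<Rightarrow> ('v, 'k) mpoly set \<Rightarrow> bool" where
  "minimal_homogeneous_generators G I \<longleftrightarrow>
     finite G \<and> (\<forall>g\<in>G. homogeneous g) \<and> Idl\<^bsub>mpoly_ring\<^esub> G = I \<and>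
     (\<forall>H. H \<subset> G \<longrightarrow> Idl\<^bsub>mpoly_ring\<^esub> H \<noteq> I)"

definition monomial_order :: "('v::finite exponent \<Rightarrow> 'v exponent \<Rightarrow> bool) \<Rightarrow> bool" where
  "monomial_order mle \<longleftrightarrow>
     class.linorder mle (\<lambda>s t. mle s t \<and> \<not> mle t s) \<and>
     (\<forall>t. mle 0 t) \<and>
     (\<forall>s t u. mle s t \<longrightarrow> mle (s + u) (t + u))"

definition initial_exponent ::
    "('v::finite exponent \<Rightarrow> 'v exponent \<Rightarrow> bool) \<Rightarrow> ('v, 'k::field) mpoly \<Rightarrow> 'v exponent" where
  "initial_exponent mle p = (THE t. t \<in> Poly_Mapping.keys p \<and> (\<forall>s\<in>Poly_Mapping.keys p. mle s t))"

text \<open>The initial monomial, without its coefficient.\<close>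

definition initial_monomial ::
    "('v::finite exponent \<Rightarrow> 'v exponent \<Rightarrow> bool) \<Rightarrow> ('v, 'k::field) mpoly \<Rightarrow> ('v, 'k) mpoly" where
  "initial_monomial mle p =
     (if p = 0 then 0 else Poly_Mapping.single (initial_exponent mle p) 1)"

definition squarefree_monomial :: "('v::finite, 'k::field) mpoly \<Rightarrow> bool" where
  "squarefree_monomial m \<longleftrightarrow> (\<exists>t. m = Poly_Mapping.single t 1 \<and> (\<forall>v. Poly_Mapping.lookup t v \<le> 1))"


section \<open>Ideals of Koenig type and Knutson ideals\<close>

text \<open>Here \<open>fs\<close> is the list \<open>[f\<^sub>1, \<dots>, f\<^sub>h]\<close>.\<close>

definition koenig_type ::
    "('v::finite exponent \<Rightarrow> 'v exponent \<Rightarrow> bool) \<Rightarrow> ('v, 'k::field) mpoly list \<Rightarrow>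
     ('v, 'k) mpoly set \<Rightarrow> bool" where
  "koenig_type mle fs I \<longleftrightarrow>
     homogeneous_ideal I \<and>
     ideal_height mpoly_ring I = enat (length fs) \<and>
     distinct fs \<and>
     (\<exists>G. minimal_homogeneous_generators G I \<and> set fs \<subseteq> G) \<and>
     monomial_order mle \<and>
     regular_sequence mpoly_ring (map (initial_monomial mle) fs)"

inductive_set knutson_class :: "('v::finite, 'k::field) mpoly \<Rightarrow> ('v, 'k) mpoly set set"
  for f :: "('v, 'k) mpoly" where
  principal: "Idl\<^bsub>mpoly_ring\<^esub> {f} \<in> knutson_class f"
| colon: "I \<in> knutson_class f \<Longrightarrow> ideal J mpoly_ring \<Longrightarrow> colon_ideal mpoly_ring I J \<in> knutson_class f"
| sum: "I \<in> knutson_class f \<Longrightarrow> J \<in> knutson_class f \<Longrightarrow> I <+>\<^bsub>mpoly_ring\<^esub> J \<in> knutson_class f"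
| inter: "I \<in> knutson_class f \<Longrightarrow> J \<in> knutson_class f \<Longrightarrow> I \<inter> J \<in> knutson_class f"

definition knutson_ideal :: "('v::finite, 'k::field) mpoly set \<Rightarrow> bool" where
  "knutson_ideal I \<longleftrightarrow>
     (\<exists>f mle. monomial_order mle \<and> squarefree_monomial (initial_monomial mle f) \<and>
             I \<in> knutson_class f)"

end

theory Submission
  imports Defs "HOL-Algebra.Ring_Divisibility"
begin

text \<open>Put \<open>f = f\<^sub>1 \<cdots> f\<^sub>h\<close>. A regular sequence of monomials is pairwise coprime, so \<open>in(f)\<close> is the
  square-free product of the \<open>in(f\<^sub>i)\<close>, and \<open>J = (f\<^sub>1, \<dots>, f\<^sub>h)\<close> is the sum of the ideals
  \<open>(f\<^sub>i) = (f) : (\<Prod>\<^bsub>j \<noteq> i\<^esub> f\<^sub>j)\<close>, hence lies in \<open>\<C>\<^sub>f\<close>. Coprimality of the leading monomials also makes the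
  \<open>f\<^sub>i\<close> a Groebner basis of \<open>J\<close> and a regular sequence; so \<open>J\<close> is radical, and every prime
  containing \<open>J\<close> has height at least \<open>h\<close>. The associated primes of the radical unmixed ideal
  \<open>I \<supseteq> J\<close> have height exactly \<open>h\<close> and are therefore minimal over \<open>J\<close>. This gives
  \<open>I = J : (J : I)\<close>, which lies in \<open>\<C>\<^sub>f\<close>.\<close>

section \<open>Ideals and primes of commutative rings\<close>

text \<open>Ideals are the submodules of the ring over itself, so \<open>ideals.subspace\<close> and
  \<open>ideals.span\<close> stand for ideals and generated ideals. The \<open>type_algebra\<close>
  lemmas translate the record-based notions into this language.\<close>

interpretation ideals: Modules.module "(*) :: 'a::comm_ring_1 \<Rightarrow> 'a \<Rightarrow> 'a"
  by unfold_locales (auto simp: algebra_simps)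

text \<open>As a rewrite rule this loops with \<open>mult.assoc\<close>.\<close>
declare ideals.scale_scale [simp del]

lemma ring_of_type_algebra_simps [simp]:
  fixes x y :: "'a::comm_ring_1"
  shows "carrier (ring_of_type_algebra :: 'a ring) = UNIV"
    and "x \<otimes>\<^bsub>ring_of_type_algebra\<^esub> y = x * y"
    and "x \<oplus>\<^bsub>ring_of_type_algebra\<^esub> y = x + y"
    and "\<one>\<^bsub>ring_of_type_algebra\<^esub> = (1 :: 'a)"
    and "\<zero>\<^bsub>ring_of_type_algebra\<^esub> = (0 :: 'a)"
  by (simp_all add: ring_of_type_algebra_def)

lemma nat_pow_type_algebra [simp]:
  fixes x :: "'a::comm_ring_1"
  shows "x [^]\<^bsub>ring_of_type_algebra\<^esub> (k::nat) = x ^ k"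
proof -
  interpret cring "ring_of_type_algebra :: 'a ring" ..
  show ?thesis by (induction k) (simp_all add: mult.commute)
qed

lemma a_inv_type_algebra [simp]:
  fixes x :: "'a::comm_ring_1"
  shows "\<ominus>\<^bsub>ring_of_type_algebra\<^esub> x = - x"
proof -
  interpret cring "ring_of_type_algebra :: 'a ring" ..
  show ?thesis using minus_equality[of "- x" x] by simp
qed

lemma ideal_type_algebra_iff:
  fixes I :: "'a::comm_ring_1 set"
  shows "ideal I ring_of_type_algebra \<longleftrightarrow> ideals.subspace I"
proof -
  interpret cring "ring_of_type_algebra :: 'a ring" ..
  show ?thesis
  proof
    assume "ideal I ring_of_type_algebra"
    then interpret ideal I "ring_of_type_algebra :: 'a ring" .
    show "ideals.subspace I"
      using zero_closed a_closed I_l_closed by (auto intro!: ideals.subspaceI)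
  next
    assume I: "ideals.subspace I"
    show "ideal I ring_of_type_algebra"
    proof (rule idealI)
      show "ring (ring_of_type_algebra :: 'a ring)" ..
      show "subgroup I (add_monoid ring_of_type_algebra)"
        by (rule add.subgroupI)
          (use I in \<open>auto simp: ideals.subspace_add ideals.subspace_neg
             dest: ideals.subspace_0 simp flip: a_inv_def\<close>)
    qed (use I in \<open>auto dest: ideals.subspace_scale simp: mult.commute\<close>)
  qed
qed

lemma genideal_type_algebra:
  fixes G :: "'a::comm_ring_1 set"
  shows "Idl\<^bsub>ring_of_type_algebra\<^esub> G = ideals.span G"
  by (simp add: genideal_def ideal_type_algebra_iff ideals.span_def hull_def)

lemma primeideal_type_algebra_iff:
  fixes P :: "'a::comm_ring_1 set"
  shows "primeideal P ring_of_type_algebra \<longleftrightarrow>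
    ideals.subspace P \<and> 1 \<notin> P \<and> (\<forall>a b. a * b \<in> P \<longrightarrow> a \<in> P \<or> b \<in> P)"
proof
  assume "primeideal P ring_of_type_algebra"
  then interpret primeideal P "ring_of_type_algebra :: 'a ring" .
  show "ideals.subspace P \<and> 1 \<notin> P \<and> (\<forall>a b. a * b \<in> P \<longrightarrow> a \<in> P \<or> b \<in> P)"
    using is_ideal I_prime I_notcarr one_imp_carrier by (auto simp: ideal_type_algebra_iff)
next
  assume "ideals.subspace P \<and> 1 \<notin> P \<and> (\<forall>a b. a * b \<in> P \<longrightarrow> a \<in> P \<or> b \<in> P)"
  then show "primeideal P ring_of_type_algebra"
    by (intro primeidealI) (auto simp: ideal_type_algebra_iff)
qed

lemma colon_ideal_type_algebra:
  fixes I J :: "'a::comm_ring_1 set"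
  shows "colon_ideal ring_of_type_algebra I J = {x. \<forall>y\<in>J. x * y \<in> I}"
  by (simp add: colon_ideal_def)

lemma subspace_colon_ideal:
  fixes I J :: "'a::comm_ring_1 set"
  assumes "ideals.subspace I"
  shows "ideals.subspace (colon_ideal ring_of_type_algebra I J)"
  by (rule ideals.subspaceI)
    (use assms in \<open>auto simp: colon_ideal_type_algebra ideals.subspace_0
      ideals.subspace_add ideals.subspace_scale distrib_right mult.assoc\<close>)

lemma set_add_type_algebra:
  fixes I J :: "'a::comm_ring_1 set"
  shows "I <+>\<^bsub>ring_of_type_algebra\<^esub> J = {x + y | x y. x \<in> I \<and> y \<in> J}"
  by (auto simp: set_add_def')

lemma radical_type_algebra_iff:
  fixes I :: "'a::comm_ring_1 set"
  shows "radical_ideal ring_of_type_algebra I \<longleftrightarrow>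
    ideals.subspace I \<and> (\<forall>x k. x ^ k \<in> I \<longrightarrow> x \<in> I)"
  by (auto simp: radical_ideal_def ideal_type_algebra_iff)

section \<open>Prime ideals avoiding a multiplicative set\<close>

text \<open>By Zorn's lemma there is an ideal maximal among those containing \<open>I\<close> and
  disjoint from \<open>S\<close>; such an ideal is prime.\<close>

lemma prime_ideal_avoiding:
  fixes I S :: "'a::comm_ring_1 set"
  assumes I: "ideals.subspace I" and S1: "1 \<in> S"
    and Smult: "\<And>s t. s \<in> S \<Longrightarrow> t \<in> S \<Longrightarrow> s * t \<in> S" and disj: "I \<inter> S = {}"
  obtains Q where "primeideal Q ring_of_type_algebra" "I \<subseteq> Q" "Q \<inter> S = {}"
proof -
  let ?A = "{Q. ideals.subspace Q \<and> I \<subseteq> Q \<and> Q \<inter> S = {}}"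
  have "\<exists>M\<in>?A. \<forall>L\<in>?A. M \<subseteq> L \<longrightarrow> L = M"
  proof (rule subset_Zorn_nonempty)
    show "?A \<noteq> {}" using I disj by auto
    fix C assume C: "C \<noteq> {}" "subset.chain ?A C"
    have sub: "\<And>Z. Z \<in> C \<Longrightarrow> ideals.subspace Z" using C(2) by (auto simp: subset.chain_def)
    have "ideals.subspace (\<Union>C)"
    proof (rule ideals.subspaceI)
      show "0 \<in> \<Union>C" using C(1) sub ideals.subspace_0 by blast
    next
      fix x y assume "x \<in> \<Union>C" "y \<in> \<Union>C"
      then obtain L Y where XY: "x \<in> L" "L \<in> C" "y \<in> Y" "Y \<in> C" by blast
      then have "L \<subseteq> Y \<or> Y \<subseteq> L" using C(2) unfolding subset_chain_def by blast
      then obtain Z where "x \<in> Z" "y \<in> Z" "Z \<in> C" using XY by blast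
      then show "x + y \<in> \<Union>C" using sub ideals.subspace_add by blast
    next
      fix c x assume "x \<in> \<Union>C"
      then show "c * x \<in> \<Union>C" using sub ideals.subspace_scale by blast
    qed
    then show "\<Union>C \<in> ?A" using C by (auto simp: subset.chain_def)
  qed
  then obtain Q where Q: "ideals.subspace Q" "I \<subseteq> Q" "Q \<inter> S = {}"
    and max: "\<And>L. ideals.subspace L \<Longrightarrow> L \<inter> S = {} \<Longrightarrow> Q \<subseteq> L \<Longrightarrow> L = Q"
    by auto
  \<comment> \<open>Adjoining \<open>a\<close> to the maximal \<open>Q\<close> must produce an
    element of \<open>S\<close>, which has the form \<open>k * a\<close> plus an element of
    \<open>Q\<close>.\<close>
  have meet: "\<exists>s k. s \<in> S \<and> s - k * a \<in> Q" if "a \<notin> Q" for a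
  proof -
    let ?L = "ideals.span (insert a Q)"
    have "a \<in> ?L" "Q \<subseteq> ?L" by (auto intro: ideals.span_base)
    then have "?L \<inter> S \<noteq> {}" using max[of ?L] \<open>a \<notin> Q\<close> by auto
    then obtain s where s: "s \<in> S" "s \<in> ?L" by blast
    have "ideals.span Q = Q" using Q(1) by simp
    then have "\<exists>k. s - k * a \<in> Q" using s(2) by (simp only: ideals.span_breakdown_eq)
    then show ?thesis using s(1) by blast
  qed
  have "a \<in> Q \<or> b \<in> Q" if ab: "a * b \<in> Q" for a b
  proof (rule ccontr)
    assume "\<not> ?thesis"
    then obtain s k t l where st: "s \<in> S" "s - k * a \<in> Q" "t \<in> S" "t - l * b \<in> Q"
      using meet by metis
    have "t * (s - k * a) + (k * a) * (t - l * b) + (k * l) * (a * b) \<in> Q"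
      using st ab Q(1) by (simp add: ideals.subspace_add ideals.subspace_scale)
    also have "t * (s - k * a) + (k * a) * (t - l * b) + (k * l) * (a * b) = s * t"
      by (simp add: algebra_simps)
    finally show False using Smult[OF st(1,3)] Q(3) by auto
  qed
  moreover have "1 \<notin> Q" using S1 Q(3) by auto
  ultimately have "primeideal Q ring_of_type_algebra"
    using Q(1) by (simp add: primeideal_type_algebra_iff)
  then show ?thesis using that Q by blast
qed

text \<open>The multiplicative set generated by \<open>g\<close> and the complement of
  \<open>P\<close> replaces localization: a prime disjoint from it lies inside \<open>P\<close> and
  omits \<open>g\<close>.\<close>

lemma prime_ideal_below_avoiding:
  fixes I P :: "'a::comm_ring_1 set"
  assumes I: "ideals.subspace I" and P: "primeideal P ring_of_type_algebra"
    and nz: "\<And>n s. s \<notin> P \<Longrightarrow> g ^ n * s \<notin> I"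
  obtains Q where "primeideal Q ring_of_type_algebra" "I \<subseteq> Q" "Q \<subseteq> P" "g \<notin> Q"
proof -
  let ?S = "{g ^ n * s | n s. s \<notin> P}"
  have P': "ideals.subspace P" "1 \<notin> P" "\<And>a b. a * b \<in> P \<Longrightarrow> a \<in> P \<or> b \<in> P"
    using P by (auto simp: primeideal_type_algebra_iff)
  have 1: "g ^ n * s \<in> ?S" if "s \<notin> P" for n s using that by blast
  obtain Q where Q: "primeideal Q ring_of_type_algebra" "I \<subseteq> Q" "Q \<inter> ?S = {}"
  proof (rule prime_ideal_avoiding[OF I, of ?S])
    show "1 \<in> ?S" using 1[of 1 0] P' by simp
    show "I \<inter> ?S = {}" using nz by auto
    fix x y assume "x \<in> ?S" "y \<in> ?S"
    then obtain n s m t where *: "x = g ^ n * s" "y = g ^ m * t" "s \<notin> P" "t \<notin> P" by blast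
    then have "x * y = g ^ (n + m) * (s * t)" by (simp add: algebra_simps power_add)
    then show "x * y \<in> ?S" using 1[of "s * t" "n + m"] P'(3) * by auto
  qed
  have "Q \<subseteq> P" using 1[of _ 0] Q(3) by auto
  moreover have "g \<notin> Q" using 1[of 1 1] P'(2) Q(3) by auto
  ultimately show ?thesis using that Q by blast
qed

text \<open>If no \<open>s\<close> outside \<open>P\<close> multiplied some \<open>g\<close> of
  \<open>P\<close> into \<open>I\<close>, there would be a prime over \<open>I\<close> inside
  \<open>P\<close> omitting \<open>g\<close>, against minimality. Finitely many elements share a
  multiplier, namely the product of the individual ones.\<close>

lemma minimal_prime_multiplier:
  fixes I P :: "'a::comm_ring_1 set"
  assumes I: "radical_ideal ring_of_type_algebra I" and P: "primeideal P ring_of_type_algebra"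
    and min: "\<And>Q. primeideal Q ring_of_type_algebra \<Longrightarrow> I \<subseteq> Q \<Longrightarrow> \<not> Q \<subset> P"
    and G: "finite G" "G \<subseteq> P"
  shows "\<exists>s. s \<notin> P \<and> (\<forall>g\<in>ideals.span G. s * g \<in> I)"
proof -
  have I': "ideals.subspace I" "\<And>x k. x ^ k \<in> I \<Longrightarrow> x \<in> I"
    using I by (auto simp: radical_type_algebra_iff)
  have P': "1 \<notin> P" "\<And>a b. a * b \<in> P \<Longrightarrow> a \<in> P \<or> b \<in> P"
    using P by (auto simp: primeideal_type_algebra_iff)
  have ex: "\<exists>s. s \<notin> P \<and> s * g \<in> I" if g: "g \<in> P" for g
  proof (rule ccontr)
    assume *: "\<not> ?thesis"
    have "g ^ n * s \<notin> I" if "s \<notin> P" for n s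
    proof
      assume "g ^ n * s \<in> I"
      \<comment> \<open>The factor \<open>g * s ^ n\<close> completes \<open>g ^ n * s\<close> to a
        full power of \<open>s * g\<close>, so that radicality of \<open>I\<close> applies.\<close>
      then have "(g * s ^ n) * (g ^ n * s) \<in> I" by (rule ideals.subspace_scale[OF I'(1)])
      then have "(s * g) ^ Suc n \<in> I" by (simp add: power_mult_distrib algebra_simps)
      then show False using I'(2) * that by blast
    qed
    then obtain Q where "primeideal Q ring_of_type_algebra" "I \<subseteq> Q" "Q \<subseteq> P" "g \<notin> Q"
      using prime_ideal_below_avoiding[OF I'(1) P] by blast
    then show False using min[of Q] g by blast
  qed
  have "\<exists>s. s \<notin> P \<and> (\<forall>g\<in>G. s * g \<in> I)"
    using G
  proof (induction G rule: finite_induct)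
    case empty
    then show ?case using P' by auto
  next
    case (insert g G)
    then obtain s where s: "s \<notin> P" "\<forall>g\<in>G. s * g \<in> I" by auto
    obtain t where t: "t \<notin> P" "t * g \<in> I" using ex insert.prems by blast
    have "s * t * x \<in> I" if "x \<in> insert g G" for x
      using that s t ideals.subspace_scale[OF I'(1), of "t * x" s]
        ideals.subspace_scale[OF I'(1), of "s * x" t] by (auto simp: algebra_simps)
    then show ?case using s t P'(2) by blast
  qed
  then obtain s where s: "s \<notin> P" "\<forall>g\<in>G. s * g \<in> I" by blast
  have "ideals.subspace {g. s * g \<in> I}"
    using subspace_colon_ideal[OF I'(1), of "{s}"]
    by (simp add: colon_ideal_type_algebra mult.commute)
  then have "ideals.span G \<subseteq> {g. s * g \<in> I}" using s by (intro ideals.span_minimal) auto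
  then show ?thesis using s by blast
qed

section \<open>Chains of primes and heights\<close>

lemma sorted_wrt_psubset_last:
  assumes "sorted_wrt (\<subset>) Ps" "Q \<in> set Ps"
  shows "Q \<subseteq> last Ps"
  using assms by (induction Ps) (auto split: if_splits)

lemma prime_chain_append:
  assumes "\<forall>Q\<in>set Ps. primeideal Q R" "sorted_wrt (\<subset>) Ps" "last Ps = Q"
    and "primeideal P R" "Q \<subset> P"
  shows "(\<forall>Q\<in>set (Ps @ [P]). primeideal Q R) \<and> sorted_wrt (\<subset>) (Ps @ [P]) \<and> last (Ps @ [P]) = P"
  using assms sorted_wrt_psubset_last[OF assms(2)] by (auto simp: sorted_wrt_append)

text \<open>A chain of length \<open>n\<close> has \<open>n + 1\<close> members, hence
  \<open>n < length Ps\<close>. The supremum need not be attained, but exceeding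
  \<open>n - 1\<close> strictly already yields a chain that is long enough.\<close>

lemma enat_le_prime_height_iff:
  assumes "primeideal P R"
  shows "enat n \<le> prime_height R P \<longleftrightarrow>
    (\<exists>Ps. n < length Ps \<and> (\<forall>Q\<in>set Ps. primeideal Q R) \<and> sorted_wrt (\<subset>) Ps \<and> last Ps = P)"
    (is "_ \<longleftrightarrow> ?rhs")
proof
  assume "enat n \<le> prime_height R P"
  show ?rhs
  proof (cases n)
    case 0
    then show ?thesis using assms by (intro exI[of _ "[P]"]) auto
  next
    case (Suc m)
    have "enat m < enat n" using Suc by simp
    also note \<open>enat n \<le> prime_height R P\<close>
    finally obtain Ps where "Ps \<noteq> []" "\<forall>Q\<in>set Ps. primeideal Q R" "sorted_wrt (\<subset>) Ps"
        "last Ps = P" "enat m < enat (length Ps - 1)"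
      unfolding prime_height_def less_SUP_iff by blast
    then show ?thesis using Suc by (intro exI[of _ Ps]) auto
  qed
next
  assume ?rhs
  then obtain Ps where "n < length Ps" "\<forall>Q\<in>set Ps. primeideal Q R" "sorted_wrt (\<subset>) Ps"
      "last Ps = P" by blast
  then show "enat n \<le> prime_height R P"
    unfolding prime_height_def by (intro SUP_upper2[of Ps]) auto
qed

lemma prime_height_psubset:
  assumes "primeideal Q R" "primeideal P R" "Q \<subset> P" "enat n \<le> prime_height R Q"
  shows "enat (Suc n) \<le> prime_height R P"
proof -
  obtain Ps where "n < length Ps" "\<forall>Q\<in>set Ps. primeideal Q R" "sorted_wrt (\<subset>) Ps" "last Ps = Q"
    using assms by (auto simp: enat_le_prime_height_iff)
  then show ?thesis
    unfolding enat_le_prime_height_iff[OF assms(2)]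
    using prime_chain_append[of Ps R Q P] assms(2,3) by (intro exI[of _ "Ps @ [P]"]) auto
qed

text \<open>The last element \<open>g\<close> is a nonzerodivisor modulo the ideal \<open>J\<close>
  of the others, so no \<open>g ^ n * s\<close> with \<open>s\<close> outside \<open>P\<close> falls
  into \<open>J\<close>. Hence some prime over \<open>J\<close> inside \<open>P\<close> omits
  \<open>g\<close>; it is strictly smaller than \<open>P\<close>, and induction bounds its
  height.\<close>

lemma regular_sequence_prime_height:
  fixes P :: "'a::comm_ring_1 set"
  assumes "primeideal P ring_of_type_algebra" "set fs \<subseteq> P"
    and "\<And>i x. i < length fs \<Longrightarrow> fs ! i * x \<in> ideals.span (set (take i fs)) \<Longrightarrow>
           x \<in> ideals.span (set (take i fs))"
  shows "enat (length fs) \<le> prime_height ring_of_type_algebra P"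
  using assms
proof (induction fs arbitrary: P rule: rev_induct)
  case Nil
  then show ?case by (simp add: zero_enat_def[symmetric])
next
  case (snoc g fs)
  let ?J = "ideals.span (set fs)"
  have reg: "x \<in> ?J" if "g * x \<in> ?J" for x
    using snoc.prems(3)[of "length fs" x] that by simp
  have powreg: "x \<in> ?J" if "g ^ n * x \<in> ?J" for n x
    using that by (induction n) (auto intro: reg simp: mult.assoc)
  have "?J \<subseteq> P"
    using snoc.prems by (intro ideals.span_minimal) (auto simp: primeideal_type_algebra_iff)
  then obtain Q where Q: "primeideal Q ring_of_type_algebra" "?J \<subseteq> Q" "Q \<subseteq> P" "g \<notin> Q"
    using prime_ideal_below_avoiding[OF ideals.subspace_span snoc.prems(1), of g "set fs"] powreg
    by blast
  have "fs ! i * x \<in> ideals.span (set (take i fs)) \<Longrightarrow> x \<in> ideals.span (set (take i fs))"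
    if "i < length fs" for i x
    using snoc.prems(3)[of i x] that by (simp add: nth_append)
  moreover have "set fs \<subseteq> Q" using Q(2) ideals.span_superset by blast
  ultimately have "enat (length fs) \<le> prime_height ring_of_type_algebra Q"
    using snoc.IH[OF Q(1)] by blast
  moreover have "Q \<subset> P" using Q snoc.prems(2) by auto
  ultimately show ?case using prime_height_psubset[OF Q(1) snoc.prems(1)] by simp
qed

section \<open>Associated primes of radical ideals\<close>

text \<open>\<open>P\<close> is finitely generated, so a single \<open>s\<close> outside
  \<open>P\<close> multiplies it into \<open>I\<close>; then \<open>I : s = P\<close>, because
  \<open>x * s\<close> in \<open>I\<close> forces \<open>x\<close> into \<open>P\<close>.\<close>

lemma minimal_prime_associated:
  fixes I :: "'a::comm_ring_1 set"
  assumes N: "noetherian_ring (ring_of_type_algebra :: 'a ring)"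
    and I: "radical_ideal ring_of_type_algebra I"
    and P: "primeideal P ring_of_type_algebra" "I \<subseteq> P"
    and min: "\<And>Q. primeideal Q ring_of_type_algebra \<Longrightarrow> I \<subseteq> Q \<Longrightarrow> \<not> Q \<subset> P"
  shows "P \<in> associated_primes ring_of_type_algebra I"
proof -
  have P': "ideals.subspace P" "\<And>a b. a * b \<in> P \<Longrightarrow> a \<in> P \<or> b \<in> P"
    using P(1) by (auto simp: primeideal_type_algebra_iff)
  obtain G where G: "finite G" "P = ideals.span G"
    using noetherian_ring.finetely_gen[OF N, of P] P'(1)
    by (auto simp: ideal_type_algebra_iff genideal_type_algebra)
  then obtain s where s: "s \<notin> P" "\<forall>g\<in>P. s * g \<in> I"
    using minimal_prime_multiplier[OF I P(1) min, of G] ideals.span_superset by blast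
  have "P = colon_ideal ring_of_type_algebra I {s}"
    using s P(2) P'(2) by (auto simp: colon_ideal_type_algebra mult.commute)
  then show ?thesis using P(1) by (auto simp: associated_primes_def)
qed

text \<open>Among the proper ideals \<open>I : (x * z)\<close> a maximal one exists by the
  Noetherian property, and it is prime. It omits \<open>x\<close>, since otherwise
  \<open>(x * z) ^ 2\<close> and then \<open>x * z\<close> would lie in \<open>I\<close>.\<close>

lemma exists_associated_prime_avoiding:
  fixes I :: "'a::comm_ring_1 set"
  assumes N: "noetherian_ring (ring_of_type_algebra :: 'a ring)"
    and I: "radical_ideal ring_of_type_algebra I" and x: "x \<notin> I"
  shows "\<exists>P\<in>associated_primes ring_of_type_algebra I. x \<notin> P"
proof -
  have I': "ideals.subspace I" "\<And>x k. x ^ k \<in> I \<Longrightarrow> x \<in> I"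
    using I by (auto simp: radical_type_algebra_iff)
  let ?c = "\<lambda>y. colon_ideal ring_of_type_algebra I {y}"
  let ?A = "{?c (x * z) | z. x * z \<notin> I}"
  have "\<exists>M\<in>?A. \<forall>L\<in>?A. M \<subseteq> L \<longrightarrow> L = M"
  proof (rule subset_Zorn_nonempty)
    show "?A \<noteq> {}" using x by (auto intro: exI[of _ 1])
    fix C assume C: "C \<noteq> {}" "subset.chain ?A C"
    then have "subset.chain {I. ideal I ring_of_type_algebra} C"
      using subspace_colon_ideal[OF I'(1)]
      by (auto simp: subset.chain_def ideal_type_algebra_iff)
    then have "\<Union>C \<in> C" by (rule noetherian_ring.ideal_chain_is_trivial[OF N C(1)])
    then show "\<Union>C \<in> ?A" using C(2) unfolding subset.chain_def by blast
  qed
  then obtain M where M: "M \<in> ?A" "\<forall>L\<in>?A. M \<subseteq> L \<longrightarrow> L = M" ..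
  then obtain z where z: "x * z \<notin> I" "M = ?c (x * z)" by auto
  have max: "?c (x * z') = ?c (x * z)" if "x * z' \<notin> I" "?c (x * z) \<subseteq> ?c (x * z')" for z'
    using M(2)[rule_format, of "?c (x * z')"] that z(2) by blast
  let ?P = "?c (x * z)"
  have mem: "a \<in> ?c y \<longleftrightarrow> a * y \<in> I" for a y by (simp add: colon_ideal_type_algebra)
  have "b \<in> ?P" if ab: "a * b \<in> ?P" and a: "a \<notin> ?P" for a b
  proof -
    \<comment> \<open>Passing from \<open>z\<close> to \<open>a * z\<close> can only enlarge the
      colon ideal; maximality leaves it unchanged, and \<open>b\<close> lies in the enlarged
      one.\<close>
    have nz: "x * (a * z) \<notin> I" using a by (simp add: mem algebra_simps)
    have "?P \<subseteq> ?c (x * (a * z))"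
    proof
      fix c assume "c \<in> ?P"
      then have "a * (c * (x * z)) \<in> I" using I'(1) by (simp add: mem ideals.subspace_scale)
      then show "c \<in> ?c (x * (a * z))" by (simp add: mem algebra_simps)
    qed
    then have "?c (x * (a * z)) = ?P" using max[OF nz] by blast
    moreover have "b \<in> ?c (x * (a * z))" using ab by (simp add: mem algebra_simps)
    ultimately show ?thesis by blast
  qed
  then have "primeideal ?P ring_of_type_algebra"
    using subspace_colon_ideal[OF I'(1)] z(1)
    by (auto simp: primeideal_type_algebra_iff mem)
  then have "?P \<in> associated_primes ring_of_type_algebra I" by (auto simp: associated_primes_def)
  moreover have "x \<notin> ?P"
  proof
    assume "x \<in> ?P"
    then have "z * (x * (x * z)) \<in> I" using I'(1) by (simp add: mem ideals.subspace_scale)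
    then have "(x * z) ^ 2 \<in> I" by (simp add: power2_eq_square algebra_simps)
    then show False using I'(2) z(1) by blast
  qed
  ultimately show ?thesis by blast
qed

lemma associated_primes_superset:
  assumes "ideals.subspace I" "P \<in> associated_primes ring_of_type_algebra (I :: 'a::comm_ring_1 set)"
  shows "I \<subseteq> P"
  using assms by (auto simp: associated_primes_def colon_ideal_type_algebra mult.commute
      intro: ideals.subspace_scale)

text \<open>The infimum defining the height of \<open>I\<close> is attained at some prime
  \<open>Q\<close>. As \<open>h\<close> is finite, \<open>Q\<close> is minimal over
  \<open>I\<close>, hence associated, and unmixedness carries its height to
  \<open>P\<close>.\<close>

lemma unmixed_associated_prime_height:
  fixes I :: "'a::comm_ring_1 set"
  assumes N: "noetherian_ring (ring_of_type_algebra :: 'a ring)"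
    and I: "radical_ideal ring_of_type_algebra I" "unmixed ring_of_type_algebra I"
    and h: "ideal_height ring_of_type_algebra I = enat h"
    and P: "P \<in> associated_primes ring_of_type_algebra I"
  shows "prime_height ring_of_type_algebra P = enat h"
proof -
  let ?R = "ring_of_type_algebra :: 'a ring"
  let ?A = "{P. primeideal P ?R \<and> I \<subseteq> P}"
  have I': "ideals.subspace I" using I by (auto simp: radical_type_algebra_iff)
  have "?A \<noteq> {}"
    using P associated_primes_superset[OF I' P] by (auto simp: associated_primes_def)
  have Inf_mem: "Inf S \<in> S" if "S \<noteq> {}" for S :: "enat set"
    using that LeastI[of "\<lambda>x. x \<in> S"] by (auto simp: Inf_enat_def)
  have "Inf (prime_height ?R ` ?A) \<in> prime_height ?R ` ?A"
    by (rule Inf_mem) (use \<open>?A \<noteq> {}\<close> in simp)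
  then obtain Q where Q: "primeideal Q ?R" "I \<subseteq> Q" "prime_height ?R Q = enat h"
    using h by (auto simp: ideal_height_def)
  have "\<not> Q' \<subset> Q" if Q': "primeideal Q' ?R" "I \<subseteq> Q'" for Q'
  proof
    assume "Q' \<subset> Q"
    have "enat h \<le> prime_height ?R Q'"
      unfolding h[symmetric] ideal_height_def by (rule INF_lower) (use Q' in auto)
    then have "enat (Suc h) \<le> enat h"
      using prime_height_psubset[OF Q'(1) Q(1) \<open>Q' \<subset> Q\<close>] Q(3) by simp
    then show False by simp
  qed
  then have "Q \<in> associated_primes ?R I"
    using minimal_prime_associated[OF N I(1) Q(1,2)] by blast
  then show ?thesis using I(2) P Q(3) by (metis unmixed_def)
qed

text \<open>The components of \<open>I\<close> are among the minimal primes of \<open>J\<close>: \<open>J : I\<close> collects the other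
  ones, and a second colon removes them.\<close>

lemma double_colon_ideal:
  fixes I J :: "'a::comm_ring_1 set"
  assumes N: "noetherian_ring (ring_of_type_algebra :: 'a ring)"
    and I: "radical_ideal ring_of_type_algebra I" "unmixed ring_of_type_algebra I"
    and h: "ideal_height ring_of_type_algebra I = enat h"
    and J: "radical_ideal ring_of_type_algebra J" "J \<subseteq> I"
    and Jh: "\<And>P. primeideal P ring_of_type_algebra \<Longrightarrow> J \<subseteq> P \<Longrightarrow>
               enat h \<le> prime_height ring_of_type_algebra P"
  shows "colon_ideal ring_of_type_algebra J (colon_ideal ring_of_type_algebra J I) = I"
proof -
  have I': "ideals.subspace I" using I by (auto simp: radical_type_algebra_iff)
  obtain G where G: "finite G" "I = ideals.span G"
    using noetherian_ring.finetely_gen[OF N, of I] I'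
    by (auto simp: ideal_type_algebra_iff genideal_type_algebra)
  have "x \<in> I" if x: "\<And>s. (\<forall>g\<in>I. s * g \<in> J) \<Longrightarrow> x * s \<in> J" for x
  proof (rule ccontr)
    assume "x \<notin> I"
    then obtain P where P: "P \<in> associated_primes ring_of_type_algebra I" "x \<notin> P"
      using exists_associated_prime_avoiding[OF N I(1)] by blast
    then have P': "primeideal P ring_of_type_algebra" "I \<subseteq> P"
      using associated_primes_superset[OF I'] by (auto simp: associated_primes_def)
    \<comment> \<open>\<open>P\<close> has height \<open>h\<close> and every prime over
      \<open>J\<close> has height at least \<open>h\<close>, so \<open>P\<close> is minimal over
      \<open>J\<close> too.\<close>
    have "\<not> Q \<subset> P" if Q: "primeideal Q ring_of_type_algebra" "J \<subseteq> Q" for Q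
    proof
      assume "Q \<subset> P"
      then have "enat (Suc h) \<le> enat h"
        using prime_height_psubset[OF Q(1) P'(1) _ Jh[OF Q]]
          unmixed_associated_prime_height[OF N I h P(1)] by simp
      then show False by simp
    qed
    then obtain s where s: "s \<notin> P" "\<forall>g\<in>I. s * g \<in> J"
      using minimal_prime_multiplier[OF J(1) P'(1) _ G(1)] G(2) P'(2) ideals.span_superset
      by blast
    then have "x * s \<in> P" using x J(2) P'(2) by blast
    then show False using P'(1) s(1) P(2) by (auto simp: primeideal_type_algebra_iff)
  qed
  then show ?thesis by (auto simp: colon_ideal_type_algebra mult.commute)
qed

section \<open>Monomial orders\<close>

definition exp_dvd :: "('v \<Rightarrow>\<^sub>0 nat) \<Rightarrow> ('v \<Rightarrow>\<^sub>0 nat) \<Rightarrow> bool" where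
  "exp_dvd s t \<longleftrightarrow> (\<forall>v. Poly_Mapping.lookup s v \<le> Poly_Mapping.lookup t v)"

definition exp_coprime :: "('v \<Rightarrow>\<^sub>0 nat) \<Rightarrow> ('v \<Rightarrow>\<^sub>0 nat) \<Rightarrow> bool" where
  "exp_coprime s t \<longleftrightarrow> (\<forall>v. Poly_Mapping.lookup s v = 0 \<or> Poly_Mapping.lookup t v = 0)"

lemma exp_dvd_diff_add: "exp_dvd s t \<Longrightarrow> (t - s) + s = t"
  by (rule poly_mapping_eqI) (simp add: exp_dvd_def lookup_add lookup_minus)

lemma exp_dvd_add [simp]: "exp_dvd s (u + s)" "exp_dvd s (s + u)"
  by (simp_all add: exp_dvd_def lookup_add)

lemma exp_dvd_refl [simp]: "exp_dvd s s"
  by (simp add: exp_dvd_def)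

lemma exp_dvd_trans: "exp_dvd s t \<Longrightarrow> exp_dvd t u \<Longrightarrow> exp_dvd s u"
  unfolding exp_dvd_def using order_trans by blast

lemma exp_coprime_sym: "exp_coprime s t \<Longrightarrow> exp_coprime t s"
  unfolding exp_coprime_def by metis

lemma exp_coprime_dvd_add: "exp_coprime s t \<Longrightarrow> exp_dvd s (t + u) \<Longrightarrow> exp_dvd s u"
  unfolding exp_coprime_def exp_dvd_def lookup_add by (metis add_0 le0)

section \<open>Dickson's lemma\<close>

text \<open>Every sequence has a monotone subsequence; if that one is nonincreasing, it is constant
  from the index \<open>k\<close> at which it attains its minimum.\<close>

lemma nat_sequence_monotone_subsequence:
  fixes s :: "nat \<Rightarrow> nat"
  shows "\<exists>r::nat \<Rightarrow> nat. strict_mono r \<and> mono (\<lambda>n. s (r n))"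
proof -
  obtain f where f: "strict_mono f" "monoseq (\<lambda>n. s (f n))"
    using seq_monosub by blast
  consider "\<forall>m. \<forall>n\<ge>m. s (f m) \<le> s (f n)" | "\<forall>m. \<forall>n\<ge>m. s (f n) \<le> s (f m)"
    using f(2) unfolding monoseq_def by blast
  then show ?thesis
  proof cases
    case 1
    then show ?thesis using f(1) by (auto simp: mono_def)
  next
    case 2
    obtain k where k: "\<And>n. s (f k) \<le> s (f n)"
      using exists_least_iff[of "\<lambda>m. \<exists>n. m = s (f n)"] by (metis not_le)
    have "s (f (n + k)) = s (f k)" for n
      using k[of "n + k"] 2 by (metis le_add2 le_antisym)
    moreover have "strict_mono (\<lambda>n. f (n + k))" using f(1) by (simp add: strict_mono_def)
    ultimately show ?thesis by (intro exI[of _ "\<lambda>n. f (n + k)"]) (simp add: mono_def)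
  qed
qed

text \<open>Subsequences are refined one variable at a time until all coordinates are nondecreasing;
  the first two surviving terms are then comparable.\<close>

theorem dickson:
  fixes t :: "nat \<Rightarrow> ('v::finite \<Rightarrow>\<^sub>0 nat)"
  obtains i j where "i < j" "exp_dvd (t i) (t j)"
proof -
  have "\<exists>r::nat \<Rightarrow> nat. strict_mono r \<and> (\<forall>v\<in>A. mono (\<lambda>n. Poly_Mapping.lookup (t (r n)) v))"
    if "finite A" for A :: "'v set"
    using that
  proof induction
    case empty
    then show ?case by (intro exI[of _ id]) (simp add: strict_mono_def)
  next
    case (insert v A)
    then obtain r :: "nat \<Rightarrow> nat" where r: "strict_mono r"
      "\<forall>v\<in>A. mono (\<lambda>n. Poly_Mapping.lookup (t (r n)) v)" by blast
    obtain q :: "nat \<Rightarrow> nat" where q: "strict_mono q" "mono (\<lambda>n. Poly_Mapping.lookup (t (r (q n))) v)"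
      using nat_sequence_monotone_subsequence[of "\<lambda>n. Poly_Mapping.lookup (t (r n)) v"] by blast
    have "strict_mono (r \<circ> q)" using r(1) q(1) by (rule strict_mono_o)
    moreover have "mono (\<lambda>n. Poly_Mapping.lookup (t ((r \<circ> q) n)) w)" if "w \<in> insert v A" for w
      using that r(2) q strict_mono_mono[OF q(1)] by (auto simp: o_def mono_def)
    ultimately show ?case by blast
  qed
  from this[of UNIV] obtain r :: "nat \<Rightarrow> nat" where "strict_mono r" "\<And>v. mono (\<lambda>n. Poly_Mapping.lookup (t (r n)) v)"
    by auto
  then have "r 0 < r 1" "exp_dvd (t (r 0)) (t (r 1))"
    by (auto simp: exp_dvd_def mono_def strict_mono_def)
  then show ?thesis using that by blast
qed

section \<open>Leading exponents for a monomial order\<close>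

locale exponent_order =
  fixes mle :: "'v::finite exponent \<Rightarrow> 'v exponent \<Rightarrow> bool"
  assumes monomial_order: "monomial_order mle"
begin

lemma mle_refl [simp]: "mle t t"
  and mle_trans: "mle s t \<Longrightarrow> mle t u \<Longrightarrow> mle s u"
  and mle_antisym: "mle s t \<Longrightarrow> mle t s \<Longrightarrow> s = t"
  and mle_total: "mle s t \<or> mle t s"
  and mle_zero: "mle 0 t"
  and mle_add: "mle s t \<Longrightarrow> mle (s + u) (t + u)"
proof -
  interpret linorder mle "\<lambda>s t. mle s t \<and> \<not> mle t s"
    using monomial_order by (simp add: monomial_order_def)
  show "mle t t" "mle s t \<Longrightarrow> mle t u \<Longrightarrow> mle s u" "mle s t \<Longrightarrow> mle t s \<Longrightarrow> s = t"
    "mle s t \<or> mle t s"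
    by (fact order.refl order.trans order.antisym linear)+
  show "mle 0 t" "mle s t \<Longrightarrow> mle (s + u) (t + u)"
    using monomial_order by (simp_all add: monomial_order_def)
qed

lemma exp_dvd_imp_mle: "exp_dvd s t \<Longrightarrow> mle s t"
  using mle_add[OF mle_zero, of s "t - s"] exp_dvd_diff_add[of s t] by simp

lemma mle_add_cong:
  assumes "mle s a" "mle t b" shows "mle (s + t) (a + b)"
  using mle_add[OF assms(1), of t] mle_add[OF assms(2), of a] mle_trans by (simp add: add.commute)

text \<open>This is what prevents cancellation in products: a sum of two upper bounds is reached
  only when both bounds are.\<close>

lemma mle_add_eqD:
  assumes "mle s a" "mle t b" "s + t = a + b"
  shows "s = a \<and> t = b"
proof -
  have "mle (a + t) (s + t)" using mle_add[OF assms(2), of a] assms(3) by (simp add: add.commute)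
  moreover have "mle (s + t) (a + t)" using mle_add[OF assms(1)] .
  ultimately have "s + t = a + t" using mle_antisym by blast
  then show ?thesis using assms(3) by simp
qed

text \<open>In an infinite strict descent, Dickson's lemma gives \<open>i < j\<close> with
  \<open>f i\<close> dividing \<open>f j\<close>, so \<open>f i\<close> would be at most
  \<open>f j\<close> and hence at most \<open>f (Suc i)\<close>.\<close>

lemma wf_mle: "wf {(s, t). mle s t \<and> s \<noteq> t}"
  unfolding wf_iff_no_infinite_down_chain
proof
  assume "\<exists>f. \<forall>i. (f (Suc i), f i) \<in> {(s, t). mle s t \<and> s \<noteq> t}"
  then obtain f where f: "\<And>i. mle (f (Suc i)) (f i)" "\<And>i. f (Suc i) \<noteq> f i" by auto
  have desc: "mle (f j) (f i)" if "i \<le> j" for i j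
    using that by (induction rule: dec_induct) (auto intro: mle_trans f)
  obtain i j where ij: "i < j" "exp_dvd (f i) (f j)" by (rule dickson)
  have "mle (f i) (f (Suc i))"
    using exp_dvd_imp_mle[OF ij(2)] desc[of "Suc i" j] ij(1) mle_trans by auto
  then show False using f[of i] mle_antisym by blast
qed

text \<open>The value \<open>lt 0\<close> is unspecified, so the facts below assume nonzero
  polynomials or treat zero as a separate case.\<close>

abbreviation lt :: "('v, 'k::field) mpoly \<Rightarrow> 'v exponent" where
  "lt \<equiv> initial_exponent mle"

lemma lt_eqI:
  assumes "t \<in> Poly_Mapping.keys p" "\<And>s. s \<in> Poly_Mapping.keys p \<Longrightarrow> mle s t"
  shows "lt p = t"
  unfolding initial_exponent_def
proof (rule the_equality)
  fix s assume "s \<in> Poly_Mapping.keys p \<and> (\<forall>u\<in>Poly_Mapping.keys p. mle u s)"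
  then show "s = t" using assms mle_antisym by metis
qed (use assms in blast)

lemma
  assumes "p \<noteq> 0"
  shows lt_in_keys: "lt p \<in> Poly_Mapping.keys p"
    and mle_lt: "s \<in> Poly_Mapping.keys p \<Longrightarrow> mle s (lt p)"
proof -
  have "\<exists>t\<in>A. \<forall>s\<in>A. mle s t" if "finite A" "A \<noteq> {}" for A
    using that
  proof (induction rule: finite_ne_induct)
    case (insert x A)
    then obtain t where t: "t \<in> A" "\<forall>s\<in>A. mle s t" by blast
    show ?case
    proof (cases "mle x t")
      case True
      then show ?thesis using t by blast
    next
      case False
      then have "mle t x" using mle_total by blast
      then have "\<forall>s\<in>insert x A. mle s x" using t mle_trans by (metis insert_iff mle_refl)
      then show ?thesis by blast
    qed
  qed simp
  then obtain t where t: "t \<in> Poly_Mapping.keys p" "\<forall>s\<in>Poly_Mapping.keys p. mle s t"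
    using assms by (metis finite_keys keys_eq_empty)
  then have "lt p = t" by (intro lt_eqI) auto
  then show "lt p \<in> Poly_Mapping.keys p" "s \<in> Poly_Mapping.keys p \<Longrightarrow> mle s (lt p)"
    using t by auto
qed

lemma lookup_lt_nonzero: "p \<noteq> 0 \<Longrightarrow> Poly_Mapping.lookup p (lt p) \<noteq> 0"
  using lt_in_keys by (simp add: in_keys_iff)

lemma lt_single [simp]: "c \<noteq> 0 \<Longrightarrow> lt (Poly_Mapping.single t c) = t"
  by (rule lt_eqI) auto

text \<open>With \<open>p1\<close> and \<open>q1\<close> the leading terms, every other part of
  \<open>p * q\<close> misses the exponent \<open>a + b\<close>, because a pair of exponents with
  that sum must be \<open>(a, b)\<close>.\<close>

lemma lookup_mult_lt:
  fixes p q :: "('v, 'k::field) mpoly"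
  assumes "p \<noteq> 0" "q \<noteq> 0"
  shows "Poly_Mapping.lookup (p * q) (lt p + lt q) =
    Poly_Mapping.lookup p (lt p) * Poly_Mapping.lookup q (lt q)"
proof -
  define a b where "a = lt p" "b = lt q"
  define p1 q1 where "p1 = Poly_Mapping.single a (Poly_Mapping.lookup p a)"
    "q1 = Poly_Mapping.single b (Poly_Mapping.lookup q b)"
  have *: "x = a \<and> y = b"
    if "x \<in> Poly_Mapping.keys p" "y \<in> Poly_Mapping.keys q" "x + y = a + b" for x y
    using mle_add_eqD[of x a y b] mle_lt assms that by (auto simp: a_b_def)
  have p1: "Poly_Mapping.keys p1 \<subseteq> {a}" "a \<in> Poly_Mapping.keys p"
    using lt_in_keys[OF assms(1)] by (auto simp: p1_q1_def a_b_def)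
  have p2: "Poly_Mapping.keys (p - p1) \<subseteq> Poly_Mapping.keys p - {a}"
    and q2: "Poly_Mapping.keys (q - q1) \<subseteq> Poly_Mapping.keys q - {b}"
    by (auto simp: p1_q1_def in_keys_iff lookup_minus lookup_single when_def split: if_splits)
  have 1: "a + b \<notin> Poly_Mapping.keys (p1 * (q - q1))"
  proof
    assume "a + b \<in> Poly_Mapping.keys (p1 * (q - q1))"
    then obtain x y where "a + b = x + y" "x \<in> Poly_Mapping.keys p1" "y \<in> Poly_Mapping.keys (q - q1)"
      using keys_mult[of p1 "q - q1"] by blast
    then show False using p1 q2 *[of x y] by auto
  qed
  have 2: "a + b \<notin> Poly_Mapping.keys ((p - p1) * q)"
  proof
    assume "a + b \<in> Poly_Mapping.keys ((p - p1) * q)"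
    then obtain x y where "a + b = x + y" "x \<in> Poly_Mapping.keys (p - p1)" "y \<in> Poly_Mapping.keys q"
      using keys_mult[of "p - p1" q] by blast
    then show False using p2 *[of x y] by auto
  qed
  have "p * q = p1 * q1 + (p1 * (q - q1) + (p - p1) * q)" by (simp add: algebra_simps)
  then have "Poly_Mapping.lookup (p * q) (a + b) = Poly_Mapping.lookup (p1 * q1) (a + b)"
    using 1 2 by (simp add: lookup_add in_keys_iff)
  then show ?thesis by (simp add: p1_q1_def mult_single a_b_def)
qed

lemma
  fixes p q :: "('v, 'k::field) mpoly"
  assumes "p \<noteq> 0" "q \<noteq> 0"
  shows mpoly_mult_nonzero: "p * q \<noteq> 0"
    and lt_mult: "lt (p * q) = lt p + lt q"
proof -
  have nz: "lt p + lt q \<in> Poly_Mapping.keys (p * q)"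
    using lookup_mult_lt[OF assms] lookup_lt_nonzero[OF assms(1)] lookup_lt_nonzero[OF assms(2)]
    by (simp add: in_keys_iff)
  then show "p * q \<noteq> 0" by auto
  have "mle s (lt p + lt q)" if "s \<in> Poly_Mapping.keys (p * q)" for s
    using that keys_mult[of p q] mle_add_cong mle_lt assms by blast
  then show "lt (p * q) = lt p + lt q" using nz by (rule lt_eqI[rotated])
qed

lemma lt_diff_less:
  fixes p q :: "('v, 'k::field) mpoly"
  assumes "p \<noteq> 0" "q \<noteq> 0" "lt q = lt p" "Poly_Mapping.lookup q (lt p) = Poly_Mapping.lookup p (lt p)"
    and "p - q \<noteq> 0"
  shows "mle (lt (p - q)) (lt p) \<and> lt (p - q) \<noteq> lt p"
proof -
  have "lt (p - q) \<in> Poly_Mapping.keys (p - q)" using assms by (intro lt_in_keys)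
  then have "lt (p - q) \<in> Poly_Mapping.keys p \<or> lt (p - q) \<in> Poly_Mapping.keys q" "lt (p - q) \<noteq> lt p"
    using assms(4) by (auto simp: in_keys_iff lookup_minus)
  then show ?thesis using mle_lt assms by metis
qed

section \<open>Division and the Noetherian property\<close>

lemma lt_reduce:
  fixes p q :: "('v, 'k::field) mpoly"
  assumes "p \<noteq> 0" "q \<noteq> 0" "exp_dvd (lt q) (lt p)"
  obtains r where "p - r * q = 0 \<or> mle (lt (p - r * q)) (lt p) \<and> lt (p - r * q) \<noteq> lt p"
proof -
  define r where "r = Poly_Mapping.single (lt p - lt q)
    (Poly_Mapping.lookup p (lt p) / Poly_Mapping.lookup q (lt q))"
  have c: "Poly_Mapping.lookup p (lt p) / Poly_Mapping.lookup q (lt q) \<noteq> 0"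
    using assms lookup_lt_nonzero by auto
  then have r: "r \<noteq> 0" "lt r = lt p - lt q"
    unfolding r_def by (metis lookup_single_eq lookup_zero, simp)
  have "lt (r * q) = lt p" "r * q \<noteq> 0"
    using lt_mult[OF r(1) assms(2)] mpoly_mult_nonzero[OF r(1) assms(2)]
      exp_dvd_diff_add[OF assms(3)] r(2) by auto
  moreover have "Poly_Mapping.lookup (r * q) (lt p) = Poly_Mapping.lookup p (lt p)"
    using lookup_mult_lt[OF r(1) assms(2)] exp_dvd_diff_add[OF assms(3)] r(2)
      lookup_lt_nonzero[OF assms(2)] by (simp add: r_def)
  ultimately show ?thesis using lt_diff_less[OF assms(1), of "r * q"] that by blast
qed

text \<open>Subtracting multiples of elements of \<open>J\<close> lowers the leading exponent, and
  well-foundedness ends the process. Only the leading exponent of \<open>y\<close> becomes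
  irreducible, which is all that later arguments use.\<close>

lemma reduced_representative:
  fixes J :: "('v, 'k::field) mpoly set"
  assumes J: "ideals.subspace J" and x: "x \<notin> J"
  obtains y where "x - y \<in> J" "y \<notin> J" "\<And>f. f \<in> J \<Longrightarrow> f \<noteq> 0 \<Longrightarrow> \<not> exp_dvd (lt f) (lt y)"
proof -
  have "\<exists>y. x - y \<in> J \<and> y \<notin> J \<and> (\<forall>f\<in>J. f \<noteq> 0 \<longrightarrow> \<not> exp_dvd (lt f) (lt y))"
    using x
  proof (induction "lt x" arbitrary: x rule: wf_induct_rule[OF wf_mle])
    case 1
    have "x \<noteq> 0" using 1(2) J ideals.subspace_0 by blast
    show ?case
    proof (cases "\<exists>f\<in>J. f \<noteq> 0 \<and> exp_dvd (lt f) (lt x)")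
      case False
      then show ?thesis using 1(2) J ideals.subspace_0 by (intro exI[of _ x]) auto
    next
      case True
      then obtain f where f: "f \<in> J" "f \<noteq> 0" "exp_dvd (lt f) (lt x)" by blast
      then obtain r where r: "x - r * f = 0 \<or> mle (lt (x - r * f)) (lt x) \<and> lt (x - r * f) \<noteq> lt x"
        using lt_reduce[OF \<open>x \<noteq> 0\<close>] by blast
      have rf: "r * f \<in> J" using J f ideals.subspace_scale by blast
      \<comment> \<open>The remainder stays outside \<open>J\<close>, hence nonzero, so its leading
        exponent is meaningful and strictly smaller.\<close>
      have "x - r * f \<notin> J" using ideals.subspace_add[OF J _ rf, of "x - r * f"] 1(2) by auto
      moreover from this have "x - r * f \<noteq> 0" using J ideals.subspace_0 by metis
      ultimately obtain y where y: "x - r * f - y \<in> J" "y \<notin> J"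
          "\<forall>f\<in>J. f \<noteq> 0 \<longrightarrow> \<not> exp_dvd (lt f) (lt y)"
        using 1(1)[of "x - r * f"] r by auto
      have "x - y \<in> J" using ideals.subspace_add[OF J y(1) rf] by (simp add: algebra_simps)
      then show ?thesis using y by blast
    qed
  qed
  then show ?thesis using that by blast
qed

text \<open>The divisibility-minimal leading exponents of an ideal \<open>P\<close> are pairwise
  incomparable, so finitely many by Dickson's lemma. One polynomial of \<open>P\<close> for each of
  them gives a generating set, by reduction.\<close>

theorem noetherian_mpoly: "noetherian_ring (mpoly_ring :: ('v, 'k::field) mpoly ring)"
proof -
  interpret ring "mpoly_ring :: ('v, 'k) mpoly ring" ..
  show ?thesis
  proof (rule noetherian_ringI)
    fix P :: "('v, 'k) mpoly set"
    assume "ideal P mpoly_ring"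
    then have P: "ideals.subspace P" by (simp add: ideal_type_algebra_iff)
    let ?L = "lt ` (P - {0})"
    let ?M = "{t \<in> ?L. \<forall>s\<in>?L. exp_dvd s t \<longrightarrow> s = t}"
    have "finite ?M"
    proof (rule ccontr)
      assume "infinite ?M"
      then obtain f :: "nat \<Rightarrow> _" where f: "inj f" "range f \<subseteq> ?M"
        using infinite_countable_subset by blast
      obtain i j where ij: "i < j" "exp_dvd (f i) (f j)" by (rule dickson)
      have "f i \<in> ?M" "f j \<in> ?M" using f(2) by auto
      then have "f i = f j" using ij(2) by blast
      then show False using f(1) ij(1) by (simp add: inj_eq)
    qed
    have below: "\<exists>s\<in>?M. exp_dvd s t" if t: "t \<in> ?L" for t
    proof -
      \<comment> \<open>Divisors are below their multiples in the monomial order, so the smallest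
        divisor of \<open>t\<close> in \<open>?L\<close> is minimal for divisibility.\<close>
      obtain s where s: "s \<in> {s \<in> ?L. exp_dvd s t}"
        "\<And>u. mle u s \<and> u \<noteq> s \<Longrightarrow> u \<notin> {s \<in> ?L. exp_dvd s t}"
        using wfE_min[OF wf_mle, of t "{s \<in> ?L. exp_dvd s t}"] t by auto
      have "u = s" if "u \<in> ?L" "exp_dvd u s" for u
        using s that exp_dvd_imp_mle exp_dvd_trans by blast
      then show ?thesis using s(1) by blast
    qed
    have "\<forall>t\<in>?L. \<exists>p. p \<in> P - {0} \<and> lt p = t" by blast
    then obtain g where g: "\<forall>t\<in>?L. g t \<in> P - {0} \<and> lt (g t) = t" by (rule bchoice[THEN exE])
    let ?A = "g ` ?M"
    have A: "?A \<subseteq> P" using g by auto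
    then have sub: "ideals.span ?A \<subseteq> P" using P by (rule ideals.span_minimal)
    have "x \<in> ideals.span ?A" if x: "x \<in> P" for x
    proof (rule ccontr)
      assume "x \<notin> ideals.span ?A"
      then obtain y where y: "x - y \<in> ideals.span ?A" "y \<notin> ideals.span ?A"
        "\<And>f. f \<in> ideals.span ?A \<Longrightarrow> f \<noteq> 0 \<Longrightarrow> \<not> exp_dvd (lt f) (lt y)"
        using reduced_representative[OF ideals.subspace_span] by blast
      \<comment> \<open>The reduced \<open>y\<close> differs from \<open>x\<close> by an element of
        \<open>P\<close>, so its leading exponent is divisible by that of some chosen generator,
        against reducedness.\<close>
      have "y \<in> P" using ideals.subspace_diff[OF P x, of "x - y"] y(1) sub by auto
      moreover have "y \<noteq> 0" using y(2) ideals.span_zero by blast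
      ultimately have "lt y \<in> ?L" by blast
      then obtain s where s: "s \<in> ?M" "exp_dvd s (lt y)" using below by blast
      have "g s \<in> P - {0} \<and> lt (g s) = s" using g s(1) by blast
      moreover have "g s \<in> ideals.span ?A" using s(1) by (intro ideals.span_base imageI)
      ultimately show False using y(3)[of "g s"] s(2) by auto
    qed
    then have "P = ideals.span ?A" using sub by blast
    then show "\<exists>A\<subseteq>carrier mpoly_ring. finite A \<and> P = Idl\<^bsub>mpoly_ring\<^esub> A"
      using \<open>finite ?M\<close> by (intro exI[of _ ?A]) (simp add: genideal_type_algebra)
  qed
qed

subsection \<open>Coprime leading monomials\<close>

text \<open>A divisibility form of the statement that the leading monomials of \<open>F\<close>
  generate the initial ideal of \<open>ideals.span F\<close>; \<open>0\<close> is excluded because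
  it has no leading exponent.\<close>

definition groebner_basis :: "('v, 'k::field) mpoly set \<Rightarrow> bool" where
  "groebner_basis F \<longleftrightarrow>
     0 \<notin> F \<and> (\<forall>p\<in>ideals.span F. p \<noteq> 0 \<longrightarrow> (\<exists>f\<in>F. exp_dvd (lt f) (lt p)))"

lemma groebner_basis_reduced_representative:
  fixes F :: "('v, 'k::field) mpoly set"
  assumes "groebner_basis F" "x \<notin> ideals.span F"
  obtains y where "x - y \<in> ideals.span F" "y \<notin> ideals.span F" "y \<noteq> 0"
    "\<And>f. f \<in> F \<Longrightarrow> \<not> exp_dvd (lt f) (lt y)"
proof -
  obtain y where "x - y \<in> ideals.span F" "y \<notin> ideals.span F"
    "\<And>f. f \<in> ideals.span F \<Longrightarrow> f \<noteq> 0 \<Longrightarrow> \<not> exp_dvd (lt f) (lt y)"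
    using reduced_representative[OF ideals.subspace_span assms(2)] by blast
  moreover have "y \<noteq> 0" using calculation(2) ideals.span_zero by blast
  moreover have "f \<in> ideals.span F \<and> f \<noteq> 0" if "f \<in> F" for f
    using that assms(1) ideals.span_base unfolding groebner_basis_def by metis
  ultimately show ?thesis using that by blast
qed

text \<open>Replace \<open>x\<close> by a reduced \<open>y\<close>. Some \<open>lt f\<close> divides
  \<open>lt g + lt y\<close>, and being coprime to \<open>lt g\<close> it divides
  \<open>lt y\<close>, which is impossible.\<close>

lemma groebner_basis_coprime_regular:
  fixes F :: "('v, 'k::field) mpoly set"
  assumes F: "groebner_basis F" and g: "g \<noteq> 0"
    and cop: "\<And>f. f \<in> F \<Longrightarrow> exp_coprime (lt f) (lt g)"
    and x: "g * x \<in> ideals.span F"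
  shows "x \<in> ideals.span F"
proof (rule ccontr)
  assume "x \<notin> ideals.span F"
  then obtain y where y: "x - y \<in> ideals.span F" "y \<notin> ideals.span F" "y \<noteq> 0"
    "\<And>f. f \<in> F \<Longrightarrow> \<not> exp_dvd (lt f) (lt y)"
    using groebner_basis_reduced_representative[OF F] by blast
  have "g * x - g * (x - y) \<in> ideals.span F"
    using x ideals.span_scale[OF y(1)] by (rule ideals.span_diff)
  then have "g * y \<in> ideals.span F" by (simp add: algebra_simps)
  then obtain f where f: "f \<in> F" "exp_dvd (lt f) (lt (g * y))"
    using F mpoly_mult_nonzero[OF g y(3)] unfolding groebner_basis_def by blast
  then have "exp_dvd (lt f) (lt y)"
    using exp_coprime_dvd_add[OF cop[OF f(1)]] lt_mult[OF g y(3)] by simp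
  then show False using y(4) f(1) by blast
qed

lemma lt_add_distinct:
  fixes p q :: "('v, 'k::field) mpoly"
  assumes "p \<noteq> 0" "q \<noteq> 0" "lt p \<noteq> lt q"
  shows "lt (p + q) = lt p \<or> lt (p + q) = lt q"
proof -
  have *: "lt (a + b) = lt b" if "a \<noteq> 0" "b \<noteq> 0" "lt a \<noteq> lt b" "mle (lt a) (lt b)"
    for a b :: "('v, 'k) mpoly"
  proof (rule lt_eqI)
    have "lt b \<notin> Poly_Mapping.keys a" using mle_lt[OF that(1)] that(3,4) mle_antisym by blast
    then show "lt b \<in> Poly_Mapping.keys (a + b)"
      using lt_in_keys[OF that(2)] by (simp add: in_keys_iff lookup_add)
    fix s assume "s \<in> Poly_Mapping.keys (a + b)"
    then have "s \<in> Poly_Mapping.keys a \<or> s \<in> Poly_Mapping.keys b" using keys_add[of a b] by blast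
    then show "mle s (lt b)"
      using mle_lt[OF that(1)] mle_lt[OF that(2)] that(4) mle_trans by blast
  qed
  show ?thesis
    using *[of p q] *[of q p] assms mle_total[of "lt p" "lt q"] by (auto simp: add.commute)
qed

text \<open>If \<open>a\<close> is reduced modulo \<open>F\<close>, the leading terms of \<open>b \<in> span F\<close> and of \<open>a * g\<close> cannot
  cancel.\<close>

lemma groebner_basis_insert_coprime:
  fixes F :: "('v, 'k::field) mpoly set"
  assumes F: "groebner_basis F" and g: "g \<noteq> 0"
    and cop: "\<And>f. f \<in> F \<Longrightarrow> exp_coprime (lt f) (lt g)"
  shows "groebner_basis (insert g F)"
  unfolding groebner_basis_def
proof (intro conjI ballI impI)
  show "0 \<notin> insert g F" using F g by (simp add: groebner_basis_def)
  fix p assume p: "p \<in> ideals.span (insert g F)" "p \<noteq> 0"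
  have F': "\<exists>f\<in>F. exp_dvd (lt f) (lt q)" if "q \<in> ideals.span F" "q \<noteq> 0" for q
    using F that by (simp add: groebner_basis_def)
  obtain k where k: "p - k * g \<in> ideals.span F" using p(1) by (auto simp: ideals.span_breakdown_eq)
  show "\<exists>f\<in>insert g F. exp_dvd (lt f) (lt p)"
  proof (cases "k \<in> ideals.span F")
    case True
    then have "(p - k * g) + g * k \<in> ideals.span F" using k by (intro ideals.span_add ideals.span_scale)
    then show ?thesis using F' p(2) by (auto simp: algebra_simps)
  next
    case False
    then obtain a where a: "k - a \<in> ideals.span F" "a \<noteq> 0" "\<And>f. f \<in> F \<Longrightarrow> \<not> exp_dvd (lt f) (lt a)"
      using groebner_basis_reduced_representative[OF F] by blast
    \<comment> \<open>Replacing \<open>k\<close> by its reduced representative \<open>a\<close>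
      changes \<open>p - k * g\<close> only by an element of the span, so \<open>b\<close> stays in
      it.\<close>
    define b where "b = p - a * g"
    have "(p - k * g) + g * (k - a) \<in> ideals.span F"
      using k a(1) by (intro ideals.span_add ideals.span_scale)
    then have b: "b \<in> ideals.span F" by (simp add: b_def algebra_simps)
    have ag: "a * g \<noteq> 0" "lt (a * g) = lt g + lt a"
      using mpoly_mult_nonzero[OF a(2) g] lt_mult[OF a(2) g] by (simp_all add: add.commute)
    show ?thesis
    proof (cases "b = 0")
      case True
      then have "p = a * g" by (simp add: b_def)
      then show ?thesis using ag by simp
    next
      case False
      then obtain f where f: "f \<in> F" "exp_dvd (lt f) (lt b)" using F' b by blast
      have "\<not> exp_dvd (lt f) (lt (a * g))"
        using exp_coprime_dvd_add[OF cop[OF f(1)]] a(3)[OF f(1)] ag(2) by auto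
      then have ne: "lt b \<noteq> lt (a * g)" using f(2) by auto
      have p': "p = b + a * g" by (simp add: b_def)
      have "lt p = lt b \<or> lt p = lt (a * g)"
        using p' lt_add_distinct[OF False ag(1) ne] by simp
      then show ?thesis using f ag(2) by auto
    qed
  qed
qed

lemma groebner_basis_coprime:
  fixes fs :: "('v, 'k::field) mpoly list"
  assumes "sorted_wrt (\<lambda>f g. exp_coprime (lt f) (lt g)) fs" "0 \<notin> set fs"
  shows "groebner_basis (set fs)"
  using assms
proof (induction fs rule: rev_induct)
  case Nil
  then show ?case by (simp add: groebner_basis_def)
next
  case (snoc g fs)
  then show ?case using groebner_basis_insert_coprime[of "set fs" g]
    by (auto simp: sorted_wrt_append)
qed

text \<open>Each initial segment is itself a Groebner basis, and the next element has a leading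
  exponent coprime to all of it.\<close>

lemma coprime_regular_sequence:
  fixes fs :: "('v, 'k::field) mpoly list"
  assumes cop: "sorted_wrt (\<lambda>f g. exp_coprime (lt f) (lt g)) fs" and nz: "0 \<notin> set fs"
    and i: "i < length fs" and x: "fs ! i * x \<in> ideals.span (set (take i fs))"
  shows "x \<in> ideals.span (set (take i fs))"
proof (rule groebner_basis_coprime_regular[OF _ _ _ x])
  show "groebner_basis (set (take i fs))"
    using cop nz in_set_takeD[of 0 i fs] by (intro groebner_basis_coprime sorted_wrt_take) auto
  show "fs ! i \<noteq> 0" using nz i by (metis nth_mem)
  fix f assume "f \<in> set (take i fs)"
  then obtain j where "j < i" "f = fs ! j" by (auto simp: in_set_conv_nth)
  then show "exp_coprime (lt f) (lt (fs ! i))"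
    using cop i by (simp add: sorted_wrt_iff_nth_less)
qed

section \<open>Square-free leading exponents and products\<close>

lemma
  fixes p :: "('v, 'k::field) mpoly"
  assumes "p \<noteq> 0"
  shows mpoly_power_nonzero: "p ^ n \<noteq> 0"
    and lookup_lt_power: "Poly_Mapping.lookup (lt (p ^ n)) v = n * Poly_Mapping.lookup (lt p) v"
proof -
  have "lt (1 :: ('v, 'k) mpoly) = 0" using lt_single[of "1::'k" 0] by simp
  then have "p ^ n \<noteq> 0 \<and> Poly_Mapping.lookup (lt (p ^ n)) v = n * Poly_Mapping.lookup (lt p) v"
    by (induction n) (use assms in \<open>auto simp: lt_mult mpoly_mult_nonzero lookup_add\<close>)
  then show "p ^ n \<noteq> 0" "Poly_Mapping.lookup (lt (p ^ n)) v = n * Poly_Mapping.lookup (lt p) v"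
    by auto
qed

text \<open>With \<open>y\<close> a reduced representative of \<open>x\<close>, a square-free
  \<open>lt f\<close> dividing \<open>k\<close> times \<open>lt y\<close> already divides
  \<open>lt y\<close>, a contradiction.\<close>

lemma squarefree_groebner_basis_radical:
  fixes F :: "('v, 'k::field) mpoly set"
  assumes F: "groebner_basis F" and sq: "\<And>f v. f \<in> F \<Longrightarrow> Poly_Mapping.lookup (lt f) v \<le> 1"
  shows "radical_ideal mpoly_ring (ideals.span F)"
  unfolding radical_type_algebra_iff
proof (intro conjI allI impI)
  show "ideals.subspace (ideals.span F)" ..
  fix x :: "('v, 'k) mpoly" and k assume x: "x ^ k \<in> ideals.span F"
  show "x \<in> ideals.span F"
  proof (rule ccontr)
    assume "x \<notin> ideals.span F"
    then obtain y where y: "x - y \<in> ideals.span F" "y \<noteq> 0"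
      "\<And>f. f \<in> F \<Longrightarrow> \<not> exp_dvd (lt f) (lt y)"
      using groebner_basis_reduced_representative[OF F] by blast
    have "x ^ n - y ^ n \<in> ideals.span F" for n
    proof (induction n)
      case 0
      then show ?case by (simp add: ideals.span_zero)
    next
      case (Suc n)
      have "x * (x ^ n - y ^ n) + y ^ n * (x - y) \<in> ideals.span F"
        using Suc y(1) by (intro ideals.span_add ideals.span_scale)
      then show ?case by (simp add: algebra_simps)
    qed
    from ideals.span_diff[OF x this[of k]] have "y ^ k \<in> ideals.span F" by simp
    then obtain f where f: "f \<in> F" "exp_dvd (lt f) (lt (y ^ k))"
      using F mpoly_power_nonzero[OF y(2)] unfolding groebner_basis_def by blast
    \<comment> \<open>A variable absent from \<open>lt y\<close> is absent from
      \<open>lt (y ^ k)\<close>, hence from \<open>lt f\<close>; elsewhere the exponent in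
      \<open>lt y\<close> is at least 1, the bound for \<open>lt f\<close>.\<close>
    have "Poly_Mapping.lookup (lt f) v \<le> Poly_Mapping.lookup (lt y) v" for v
    proof (cases "Poly_Mapping.lookup (lt y) v = 0")
      case True
      then show ?thesis using f(2) lookup_lt_power[OF y(2), of k v] unfolding exp_dvd_def
        by (metis mult_0_right)
    next
      case False
      then show ?thesis using sq[OF f(1), of v] by linarith
    qed
    then show False using y(3)[OF f(1)] by (simp add: exp_dvd_def)
  qed
qed

lemma
  fixes fs :: "('v, 'k::field) mpoly list"
  assumes "0 \<notin> set fs"
  shows prod_list_mpoly_nonzero: "prod_list fs \<noteq> 0"
    and lt_prod_list: "lt (prod_list fs) = sum_list (map lt fs)"
proof -
  have "lt (1 :: ('v, 'k) mpoly) = 0" using lt_single[of "1::'k" 0] by simp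
  then have "prod_list fs \<noteq> 0 \<and> lt (prod_list fs) = sum_list (map lt fs)"
    using assms by (induction fs) (auto simp: lt_mult mpoly_mult_nonzero)
  then show "prod_list fs \<noteq> 0" "lt (prod_list fs) = sum_list (map lt fs)" by auto
qed

end

text \<open>By coprimality the variable \<open>v\<close> occurs in at most one member of
  \<open>ts\<close>.\<close>

lemma sum_list_coprime_squarefree:
  assumes "sorted_wrt exp_coprime ts" "\<And>t. t \<in> set ts \<Longrightarrow> Poly_Mapping.lookup t v \<le> 1"
  shows "Poly_Mapping.lookup (sum_list ts) v \<le> 1"
  using assms
proof (induction ts)
  case (Cons t ts)
  show ?case
  proof (cases "Poly_Mapping.lookup t v = 0")
    case True
    then show ?thesis using Cons by (simp add: lookup_add)
  next
    case False
    then have "\<forall>s\<in>set ts. Poly_Mapping.lookup s v = 0"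
      using Cons.prems(1) unfolding sorted_wrt.simps exp_coprime_def by metis
    then have "Poly_Mapping.lookup (sum_list ts) v = 0"
      by (induction ts) (auto simp: lookup_add)
    then show ?thesis using Cons.prems(2)[of t] by (simp add: lookup_add)
  qed
qed simp

section \<open>Monomial ideals and regular sequences of monomials\<close>

text \<open>The polynomials all of whose exponents are divisible by members of \<open>T\<close> form
  an ideal containing the generators.\<close>

lemma exp_dvd_keys_of_monomial_span:
  fixes p :: "('v::finite, 'k::field) mpoly"
  assumes p: "p \<in> ideals.span ((\<lambda>t. Poly_Mapping.single t 1) ` T)" and s: "s \<in> Poly_Mapping.keys p"
  shows "\<exists>t\<in>T. exp_dvd t s"
proof -
  let ?M = "{p :: ('v, 'k) mpoly. \<forall>s\<in>Poly_Mapping.keys p. \<exists>t\<in>T. exp_dvd t s}"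
  have "ideals.subspace ?M"
  proof (rule ideals.subspaceI)
    fix p q :: "('v, 'k) mpoly" assume "p \<in> ?M" "q \<in> ?M"
    then show "p + q \<in> ?M" using keys_add[of p q] by blast
  next
    fix c p :: "('v, 'k) mpoly" assume p: "p \<in> ?M"
    have "\<exists>t\<in>T. exp_dvd t s" if s: "s \<in> Poly_Mapping.keys (c * p)" for s
    proof -
      obtain a b where ab: "s = a + b" "b \<in> Poly_Mapping.keys p"
        using s keys_mult[of c p] by blast
      then obtain t where "t \<in> T" "exp_dvd t b" using p by blast
      then show ?thesis using ab(1) exp_dvd_trans exp_dvd_add(1) by blast
    qed
    then show "c * p \<in> ?M" by blast
  qed simp
  moreover have "(\<lambda>t. Poly_Mapping.single t 1) ` T \<subseteq> ?M" by (auto, metis exp_dvd_refl)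
  ultimately show ?thesis using ideals.span_minimal p s by blast
qed

text \<open>If \<open>ts ! i\<close> and \<open>ts ! j\<close> share a variable, dividing it out of
  \<open>ts ! i\<close> gives a monomial that \<open>ts ! j\<close> multiplies into the ideal of the
  earlier ones. Regularity puts this monomial into that ideal, which contradicts coprimality of the
  earlier monomials or properness.\<close>

lemma regular_monomials_coprime:
  fixes ts :: "('v::finite) exponent list"
  assumes reg: "regular_sequence (mpoly_ring :: ('v, 'k::field) mpoly ring)
    (map (\<lambda>t. Poly_Mapping.single t 1) ts)"
  shows "sorted_wrt exp_coprime ts"
proof -
  let ?m = "\<lambda>t :: 'v exponent. Poly_Mapping.single t (1 :: 'k)"
  have reg': "x \<in> ideals.span (?m ` set (take j ts))"
    if "j < length ts" "?m (ts ! j) * x \<in> ideals.span (?m ` set (take j ts))" for j x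
    using reg that by (simp add: regular_sequence_def genideal_type_algebra take_map)
  have proper: "1 \<notin> ideals.span (?m ` set ts)"
  proof
    assume "1 \<in> ideals.span (?m ` set ts)"
    then have "x \<in> ideals.span (?m ` set ts)" for x
      using ideals.span_scale[of 1 _ x] by simp
    then show False using reg by (auto simp: regular_sequence_def genideal_type_algebra)
  qed
  have "\<forall>i<j. exp_coprime (ts ! i) (ts ! j)" if "j < length ts" for j
    using that
  proof (induction j rule: less_induct)
    case (less j)
    show ?case
    proof (intro allI impI, rule ccontr)
      fix i assume i: "i < j" and "\<not> exp_coprime (ts ! i) (ts ! j)"
      then obtain v where v: "Poly_Mapping.lookup (ts ! i) v \<noteq> 0" "Poly_Mapping.lookup (ts ! j) v \<noteq> 0"
        by (auto simp: exp_coprime_def)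
      define e where "e = Poly_Mapping.single v (1::nat)"
      have "exp_dvd e (ts ! i)" "exp_dvd e (ts ! j)"
        using v by (auto simp: exp_dvd_def e_def lookup_single when_def)
      then obtain a b where ab: "ts ! i = a + e" "ts ! j = b + e"
        using exp_dvd_diff_add by metis
      have in_take: "ts ! i \<in> set (take j ts)" using i less.prems by (auto simp: in_set_conv_nth)
      have "?m b * ?m (ts ! i) \<in> ideals.span (?m ` set (take j ts))"
        using in_take by (intro ideals.span_scale ideals.span_base imageI)
      \<comment> \<open>Both sides have exponent \<open>a + b + e\<close>: the shared variable can
        be moved from one factor to the other.\<close>
      then have "?m (ts ! j) * ?m a \<in> ideals.span (?m ` set (take j ts))"
        by (simp add: ab mult_single add_ac)
      then have "?m a \<in> ideals.span (?m ` set (take j ts))"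
        using reg' less.prems by blast
      then obtain t where "t \<in> set (take j ts)" "exp_dvd t a"
        using exp_dvd_keys_of_monomial_span[of "?m a" "set (take j ts)" a] by auto
      then obtain k where k: "k < j" "exp_dvd (ts ! k) a"
        by (auto simp: in_set_conv_nth)
      \<comment> \<open>The exponent of \<open>v\<close> in \<open>ts ! i\<close> is one more than
        in \<open>a\<close>.\<close>
      have "\<not> exp_dvd (ts ! i) a"
        by (auto simp: ab exp_dvd_def lookup_add e_def intro!: exI[of _ v])
      then have "k \<noteq> i" using k(2) by blast
      then have "exp_coprime (ts ! k) (ts ! i)"
        using less.IH[of i] less.IH[of k] i k(1) less.prems exp_coprime_sym
        by (metis less_trans linorder_neqE_nat)
      \<comment> \<open>Thus \<open>ts ! k\<close> divides \<open>ts ! i\<close> although the two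
        are coprime, so it is the exponent of the monomial 1.\<close>
      moreover have "exp_dvd (ts ! k) (ts ! i + 0)"
        using exp_dvd_trans[OF k(2), of "ts ! i"] ab(1) by simp
      ultimately have "exp_dvd (ts ! k) 0" by (rule exp_coprime_dvd_add)
      then have "ts ! k = 0" by (intro poly_mapping_eqI) (simp add: exp_dvd_def)
      then have "?m (ts ! k) = 1" by simp
      moreover have "?m (ts ! k) \<in> ideals.span (?m ` set ts)"
        using k(1) less.prems by (intro ideals.span_base imageI) auto
      ultimately show False using proper by simp
    qed
  qed
  then show ?thesis by (auto simp: sorted_wrt_iff_nth_less)
qed

section \<open>Membership in the Knutson class of a product\<close>

context exponent_order
begin

text \<open>The polynomial ring is a domain, so \<open>q\<close> can be cancelled.\<close>

lemma colon_principal_mult: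
  fixes g q :: "('v, 'k::field) mpoly"
  assumes q: "q \<noteq> 0"
  shows "colon_ideal mpoly_ring (ideals.span {g * q}) (ideals.span {q}) = ideals.span {g}"
proof -
  have cancel: "x = c * g" if "x * q = c * (g * q)" for x c
  proof (rule ccontr)
    assume "x \<noteq> c * g"
    then have "(x - c * g) * q \<noteq> 0" using q by (intro mpoly_mult_nonzero) auto
    then show False using that by (simp add: algebra_simps)
  qed
  show ?thesis
  proof (rule equalityI; rule subsetI)
    fix x assume "x \<in> colon_ideal mpoly_ring (ideals.span {g * q}) (ideals.span {q})"
    then have "x * q \<in> ideals.span {g * q}" by (simp add: colon_ideal_type_algebra ideals.span_base)
    then show "x \<in> ideals.span {g}" using cancel by (auto simp: ideals.span_singleton)
  next
    fix x assume "x \<in> ideals.span {g}"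
    then obtain c where c: "x = c * g" by (auto simp: ideals.span_singleton)
    have "x * (d * q) = (c * d) * (g * q)" for d by (simp add: c algebra_simps)
    then show "x \<in> colon_ideal mpoly_ring (ideals.span {g * q}) (ideals.span {q})"
      by (auto simp: colon_ideal_type_algebra ideals.span_singleton)
  qed
qed

lemma knutson_class_factor:
  fixes g q :: "('v, 'k::field) mpoly"
  assumes "q \<noteq> 0"
  shows "ideals.span {g} \<in> knutson_class (g * q)"
  using knutson_class.colon[OF knutson_class.principal[of "g * q"], of "ideals.span {q}"]
  by (simp add: genideal_type_algebra ideal_type_algebra_iff colon_principal_mult[OF assms])

text \<open>Each factor's principal ideal is a colon of the principal ideal of the product by the
  cofactor; the class is closed under binary sums, so induction starts from one factor.\<close>

lemma knutson_class_span_factors: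
  fixes fs :: "('v, 'k::field) mpoly list"
  assumes nz: "0 \<notin> set fs" and ne: "fs \<noteq> []"
  shows "ideals.span (set fs) \<in> knutson_class (prod_list fs)"
proof -
  have factor: "ideals.span {g} \<in> knutson_class (prod_list fs)" if g: "g \<in> set fs" for g
  proof -
    obtain xs ys where fs: "fs = xs @ g # ys" using split_list[OF g] by blast
    have "prod_list (xs @ ys) \<noteq> 0" using nz fs by (intro prod_list_mpoly_nonzero) auto
    moreover have "prod_list fs = g * prod_list (xs @ ys)" by (simp add: fs algebra_simps)
    ultimately show ?thesis using knutson_class_factor by simp
  qed
  have "ideals.span G \<in> knutson_class (prod_list fs)" if "finite G" "G \<noteq> {}" "G \<subseteq> set fs" for G
    using that
  proof (induction rule: finite_ne_induct)
    case (singleton g)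
    then show ?case using factor by simp
  next
    case (insert g G)
    have "ideals.span (insert g G) = ideals.span {g} <+>\<^bsub>mpoly_ring\<^esub> ideals.span G"
      using ideals.span_Un[of "{g}" G] by (simp add: set_add_type_algebra)
    then show ?case using insert factor[of g] knutson_class.sum by simp
  qed
  then show ?thesis using ne by simp
qed

end

theorem proposition3p2:
  fixes I :: "('v::finite, 'k::field) mpoly set"
    and h :: nat
    and fs :: "('v, 'k) mpoly list"
    and mle :: "'v exponent \<Rightarrow> 'v exponent \<Rightarrow> bool"
  assumes "ideal I mpoly_ring"
    and "homogeneous_ideal I"
    and "unmixed mpoly_ring I"
    and "radical_ideal mpoly_ring I"
    and "ideal_height mpoly_ring I = enat h"
    and "h \<ge> 1"
    and "length fs = h"
    and "koenig_type mle fs I"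
    and "\<And>i. i < h \<Longrightarrow> squarefree_monomial (initial_monomial mle (fs ! i))"
  shows "knutson_ideal I"
proof -
  interpret exponent_order mle
    using assms(8) by unfold_locales (simp add: koenig_type_def)
  \<comment> \<open>The zero polynomial has initial monomial 0, which is not a square-free
    monomial.\<close>
  have nonzero: "f \<noteq> 0" and squarefree: "Poly_Mapping.lookup (lt f) v \<le> 1" if "f \<in> set fs" for f v
  proof -
    obtain t where t: "initial_monomial mle f = Poly_Mapping.single t 1"
      "\<forall>v. Poly_Mapping.lookup t v \<le> 1"
      using assms(7,9) \<open>f \<in> set fs\<close> by (auto simp: squarefree_monomial_def in_set_conv_nth)
    show "f \<noteq> 0"
    proof
      assume "f = 0"
      then have "Poly_Mapping.single t 1 = (0 :: ('v, 'k) mpoly)"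
        using t(1) by (simp add: initial_monomial_def)
      then show False by (metis lookup_single_eq lookup_zero zero_neq_one)
    qed
    then have "Poly_Mapping.single (lt f) 1 = (Poly_Mapping.single t 1 :: ('v, 'k) mpoly)"
      using t(1) by (simp add: initial_monomial_def)
    then have "lt f = t" by (metis lt_single zero_neq_one)
    then show "Poly_Mapping.lookup (lt f) v \<le> 1" using t(2) by simp
  qed
  then have nz: "0 \<notin> set fs" by blast
  have "map (initial_monomial mle) fs = map (\<lambda>t. Poly_Mapping.single t 1) (map lt fs)"
    using nonzero by (simp add: initial_monomial_def)
  moreover have "regular_sequence mpoly_ring (map (initial_monomial mle) fs)"
    using assms(8) by (simp add: koenig_type_def)
  ultimately have "sorted_wrt exp_coprime (map lt fs)"
    by (intro regular_monomials_coprime[where 'k = 'k]) (simp only:)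
  then have cop: "sorted_wrt (\<lambda>f g. exp_coprime (lt f) (lt g)) fs"
    by (simp add: sorted_wrt_map)
  define J where "J = ideals.span (set fs)"
  have "radical_ideal mpoly_ring J"
    unfolding J_def using groebner_basis_coprime[OF cop nz] squarefree
    by (rule squarefree_groebner_basis_radical)
  moreover have "J \<subseteq> I"
  proof -
    have "set fs \<subseteq> I"
      using assms(8) ideals.span_superset
      by (fastforce simp: koenig_type_def minimal_homogeneous_generators_def genideal_type_algebra)
    then show ?thesis
      unfolding J_def using assms(1) by (intro ideals.span_minimal) (simp_all add: ideal_type_algebra_iff)
  qed
  moreover have "enat h \<le> prime_height mpoly_ring P"
    if "primeideal P mpoly_ring" "J \<subseteq> P" for P
    using regular_sequence_prime_height[OF that(1), of fs] coprime_regular_sequence[OF cop nz]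
      that(2) ideals.span_superset assms(7) unfolding J_def by blast
  ultimately have "colon_ideal mpoly_ring J (colon_ideal mpoly_ring J I) = I"
    using double_colon_ideal[OF noetherian_mpoly assms(4,3,5)] by blast
  \<comment> \<open>Here \<open>h \<ge> 1\<close> supplies a first factor.\<close>
  moreover have J: "J \<in> knutson_class (prod_list fs)"
    unfolding J_def using nz assms(6,7) by (intro knutson_class_span_factors) auto
  moreover have "ideal (colon_ideal mpoly_ring J I) mpoly_ring"
    by (simp add: ideal_type_algebra_iff subspace_colon_ideal J_def)
  \<comment> \<open>Close the class under the colon by the ideal \<open>J : I\<close> and rewrite
    \<open>J : (J : I)\<close> to \<open>I\<close>.\<close>
  ultimately have "I \<in> knutson_class (prod_list fs)"
    using knutson_class.colon by metis
  moreover have "squarefree_monomial (initial_monomial mle (prod_list fs))"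
  proof -
    have "Poly_Mapping.lookup (sum_list (map lt fs)) v \<le> 1" for v
      by (rule sum_list_coprime_squarefree) (use \<open>sorted_wrt exp_coprime (map lt fs)\<close> squarefree in auto)
    then show ?thesis
      using prod_list_mpoly_nonzero[OF nz]
      by (auto simp: squarefree_monomial_def initial_monomial_def lt_prod_list[OF nz])
  qed
  ultimately show ?thesis
    using monomial_order unfolding knutson_ideal_def by blast
qed

end
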